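(* There is a finitary argumentation framework $\mathcal{F}$ with $\mathit{tfstg2}(\mathcal{F})=\emptyset$, i.e., with no $\mathit{tfstg2}$ extension.
   Context: An argumentation framework (AF) is a pair $\mathcal{F}=(A_{\mathcal{F}},R_{\mathcal{F}})$ with $R_{\mathcal{F}}\subseteq A_{\mathcal{F}}\times A_{\mathcal{F}}$; write $a\rightarrow b$ for $(a,b)\in R_{\mathcal{F}}$. $\mathcal{F}$ is finitary if every argument is attacked by only finitely many arguments. For $S\subseteq A_{\mathcal{F}}$, $\mathcal{F}|_S=(A_{\mathcal{F}}\cap S,R_{\mathcal{F}}\cap(S\times S))$; $S$ is conflict-free if no $a,b\in S$ have $a\rightarrow b$; $S^\oplus=S\cup\{x:\exists y\in S,\ y\rightarrow x\}$; a stage extension is a conflict-free $S$ such that no conflict-free $T$ has $S^\oplus\subsetneq T^\oplus$. $\mathrm{SCC}(a)$ is the set of $b$ with directed attack paths (possibly of length 0) from $a$ to $b$ and from $b$ to $a$. For $X,S\subseteq A_{\mathcal{F}}$, $D_S(X)=\{b\in X:\exists a\in S\setminus X,\ a\rightarrow b\}$. For $S\subseteq A_{\mathcal{F}}$, $a\in A_{\mathcal{F}}$ and ordinals $\alpha$: $C^0_S(a)=\mathrm{SCC}(a)$; $C^{\alpha+1}_S(a)$ = the strongly connected component of $a$ in $\mathcal{F}|_{C^\alpha_S(a)\setminus D_S(C^\alpha_S(a))}$ (empty if $a$ is not in that set); for limit $\lambda$, $C^\lambda_S(a)$ = the strongly connected component of $a$ in $\mathcal{F}|_{\bigcap_{\alpha<\lambda}C^\alpha_S(a)}$.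 $\alpha_S(a)$ is the least $\alpha$ with $a\notin C^\alpha_S(a)$ or $C^{\alpha+1}_S(a)=C^\alpha_S(a)$. $S\in\mathit{tfstg2}(\mathcal{F})$ iff $S$ is conflict-free and for each $a\in A_{\mathcal{F}}$, either $a\notin C^{\alpha_S(a)}_S(a)$ or $S\cap C^{\alpha_S(a)}_S(a)$ is a stage extension of $\mathcal{F}|_{C^{\alpha_S(a)}_S(a)}$. *)

theory Defs
  imports Main
begin

type_synonym 'a AF = "'a set \<times> ('a \<times> 'a) set"

definition args :: "'a AF \<Rightarrow> 'a set" where "args F = fst F"
definition atts :: "'a AF \<Rightarrow> ('a \<times> 'a) set" where "atts F = snd F"

definition wf_AF :: "'a AF \<Rightarrow> bool" where
  "wf_AF F \<longleftrightarrow> atts F \<subseteq> args F \<times> args F"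

definition finitary :: "'a AF \<Rightarrow> bool" where
  "finitary F \<longleftrightarrow> (\<forall>b\<in>args F. finite {a. (a, b) \<in> atts F})"

definition restrict :: "'a AF \<Rightarrow> 'a set \<Rightarrow> 'a AF" where
  "restrict F S = (args F \<inter> S, atts F \<inter> (S \<times> S))"

definition conflict_free :: "'a AF \<Rightarrow> 'a set \<Rightarrow> bool" where
  "conflict_free F S \<longleftrightarrow> S \<subseteq> args F \<and> (\<forall>a\<in>S. \<forall>b\<in>S. (a, b) \<notin> atts F)"

definition range_plus :: "'a AF \<Rightarrow> 'a set \<Rightarrow> 'a set" where
  "range_plus F S = S \<union> {x. \<exists>y\<in>S. (y, x) \<in> atts F}"

definition stage_ext :: "'a AF \<Rightarrow> 'a set \<Rightarrow> bool" where
  "stage_ext F S \<longleftrightarrow> conflict_free F S \<and>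
     \<not> (\<exists>T. conflict_free F T \<and> range_plus F S \<subset> range_plus F T)"

text \<open>Strongly connected component of a (empty if a is not an argument).\<close>
definition scc :: "'a AF \<Rightarrow> 'a \<Rightarrow> 'a set" where
  "scc F a = {b. a \<in> args F \<and> b \<in> args F \<and> (a, b) \<in> (atts F)\<^sup>* \<and> (b, a) \<in> (atts F)\<^sup>*}"

definition Dset :: "'a AF \<Rightarrow> 'a set \<Rightarrow> 'a set \<Rightarrow> 'a set" where
  "Dset F S X = {b \<in> X. \<exists>a\<in>S - X. (a, b) \<in> atts F}"

definition Cstep :: "'a AF \<Rightarrow> 'a set \<Rightarrow> 'a \<Rightarrow> 'a set \<Rightarrow> 'a set" where
  "Cstep F S a X = scc (restrict F (X - Dset F S X)) a"

text \<open>The transfinite sequence (C^alpha_S(a))_alpha, represented as the set of all its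
  values (the smallest family containing C^0, closed under the successor step and under
  the limit step applied to intersections of nonempty subfamilies).\<close>
inductive_set Ctower :: "'a AF \<Rightarrow> 'a set \<Rightarrow> 'a \<Rightarrow> 'a set set"
  for F :: "'a AF" and S :: "'a set" and a :: 'a where
  base: "scc F a \<in> Ctower F S a"
| succ: "X \<in> Ctower F S a \<Longrightarrow> Cstep F S a X \<in> Ctower F S a"
| lim: "Y \<noteq> {} \<Longrightarrow> (\<forall>X\<in>Y. X \<in> Ctower F S a) \<Longrightarrow> scc (restrict F (\<Inter>Y)) a \<in> Ctower F S a"

text \<open>C^(alpha_S(a))_S(a): the earliest (i.e. largest) stage X at which the sequence
  stops, i.e. a is not in X or the successor step does not change X.\<close>
definition Cfinal :: "'a AF \<Rightarrow> 'a set \<Rightarrow> 'a \<Rightarrow> 'a set" where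
  "Cfinal F S a = (THE X. X \<in> Ctower F S a \<and> (a \<notin> X \<or> Cstep F S a X = X) \<and>
      (\<forall>Y\<in>Ctower F S a. (a \<notin> Y \<or> Cstep F S a Y = Y) \<longrightarrow> Y \<subseteq> X))"

definition tfstg2 :: "'a AF \<Rightarrow> 'a set set" where
  "tfstg2 F = {S. conflict_free F S \<and>
     (\<forall>a\<in>args F. a \<notin> Cfinal F S a \<or>
        stage_ext (restrict F (Cfinal F S a)) (S \<inter> Cfinal F S a))}"

end

theory Submission
  imports Defs "HOL-Library.Countable"
begin

text \<open>
  The framework realises Yablo's paradox. It consists of levels \<open>j = 0, 1, 2, \<dots>\<close>, each a single
  strongly connected component, and higher levels attack lower ones. All paths of level \<open>j\<close> leading
  back to the pair \<open>C True, C False\<close> run through one of infinitely many connectors \<open>K i\<close>, and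
  \<open>K i\<close> is deleted iff level \<open>j + i + 1\<close> contains an accepted argument \<open>P t s\<close> with \<open>s \<noteq> t\<close>;
  call such a level crossed.

  If some connector survives, level \<open>j\<close> remains in one piece, and comparing ranges over the whole
  piece (where \<open>G t\<close> rewards crossing) makes level \<open>j\<close> crossed. If all connectors are deleted, the
  component falls apart: first some \<open>C u\<close> is accepted, its attacks then isolate the piece
  \<open>P u True, P u False, H u\<close>, and \<open>H u\<close> forces \<open>P u u\<close>, so level \<open>j\<close> is not crossed. Hence level
  \<open>j\<close> is crossed iff some higher level is not, which no assignment of truth values satisfies.
\<close>

section \<open>Strongly connected components and the transfinite sequence\<close>

lemma args_restrict [simp]: "args (restrict F X) = args F \<inter> X"
  by (simp add: restrict_def args_def)

lemma atts_restrict [simp]: "atts (restrict F X) = atts F \<inter> X \<times> X"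
  by (simp add: restrict_def atts_def)

lemma restrict_restrict: "restrict (restrict F X) Y = restrict F (X \<inter> Y)"
  by (auto simp: restrict_def args_def atts_def)

lemma wf_AF_restrict: "wf_AF F \<Longrightarrow> wf_AF (restrict F X)"
  by (auto simp: wf_AF_def)

lemma scc_subset_args: "scc F a \<subseteq> args F"
  by (auto simp: scc_def)

lemma scc_mono:
  assumes "args F \<subseteq> args G" "atts F \<subseteq> atts G"
  shows "scc F a \<subseteq> scc G a"
  using assms rtrancl_mono[of "atts F" "atts G"] by (auto simp: scc_def)

text \<open>A path between two members stays inside the component, because each vertex on it is
  reachable from \<open>a\<close> and leads back to \<open>a\<close>.\<close>

lemma scc_restrict_scc:
  assumes "wf_AF F"
  shows "scc (restrict F (scc F a)) a = scc F a"
proof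
  show "scc (restrict F (scc F a)) a \<subseteq> scc F a"
    by (rule scc_mono) auto
  let ?r = "atts (restrict F (scc F a))"
  have path: "(x, y) \<in> ?r\<^sup>*"
    if "(x, y) \<in> (atts F)\<^sup>*" "x \<in> scc F a" "y \<in> scc F a" for x y
    using that(1,2)
  proof (induction rule: converse_rtrancl_induct)
    case base
    show ?case by simp
  next
    case (step x z)
    have "z \<in> args F" using step.hyps(1) assms by (auto simp: wf_AF_def)
    moreover have "(a, z) \<in> (atts F)\<^sup>*"
      using step.hyps(1) step.prems by (auto simp: scc_def intro: rtrancl_into_rtrancl)
    moreover have "(z, a) \<in> (atts F)\<^sup>*"
      using step.hyps(2) \<open>y \<in> scc F a\<close> by (auto simp: scc_def)
    ultimately have "z \<in> scc F a" using step.prems by (auto simp: scc_def)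
    then show ?case
      using step by (auto intro: converse_rtrancl_into_rtrancl)
  qed
  show "scc F a \<subseteq> scc (restrict F (scc F a)) a"
  proof
    fix b assume b: "b \<in> scc F a"
    then have a: "a \<in> scc F a" by (auto simp: scc_def)
    show "b \<in> scc (restrict F (scc F a)) a"
      using a b path[of a b] path[of b a] by (auto simp: scc_def)
  qed
qed

text \<open>Half of showing that a value of the sequence is fixed by \<open>Cstep\<close>; the other
  half is that nothing is deleted from it.\<close>

lemma scc_restrict_idem:
  assumes "wf_AF F" "Z = scc (restrict F Y) a"
  shows "scc (restrict F Z) a = Z"
proof -
  have "Z \<subseteq> Y" using assms(2) scc_subset_args[of "restrict F Y" a] by auto
  then have "restrict F Z = restrict (restrict F Y) Z"
    by (simp add: restrict_restrict Int_absorb1)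
  then show ?thesis
    using scc_restrict_scc[OF wf_AF_restrict[OF assms(1)], of Y a] assms(2) by simp
qed

lemma rtrancl_closed:
  assumes "(x, y) \<in> r\<^sup>*" "x \<in> B" "\<And>u v. (u, v) \<in> r \<Longrightarrow> u \<in> B \<Longrightarrow> v \<in> B"
  shows "y \<in> B"
  using assms(1,2) by (induction rule: rtrancl_induct) (auto dest: assms(3))

lemma rtrancl_backward_closed:
  assumes "(x, y) \<in> r\<^sup>*" "y \<in> B" "\<And>u v. (u, v) \<in> r \<Longrightarrow> v \<in> B \<Longrightarrow> u \<in> B"
  shows "x \<in> B"
  using assms(1,2) by (induction rule: converse_rtrancl_induct) (auto dest: assms(3))

text \<open>A certificate for computing components: \<open>U\<close> is closed under attacks and
  bounds what \<open>a\<close> reaches, \<open>D\<close> is closed backwards and bounds what reaches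
  \<open>a\<close>.\<close>

lemma scc_eqI:
  assumes "a \<in> Q" "Q \<subseteq> args F"
    and "\<And>x. x \<in> Q \<Longrightarrow> (a, x) \<in> (atts F)\<^sup>*" "\<And>x. x \<in> Q \<Longrightarrow> (x, a) \<in> (atts F)\<^sup>*"
    and "a \<in> U" "\<And>x y. (x, y) \<in> atts F \<Longrightarrow> x \<in> U \<Longrightarrow> y \<in> U"
    and "a \<in> D" "\<And>x y. (x, y) \<in> atts F \<Longrightarrow> y \<in> D \<Longrightarrow> x \<in> D"
    and "U \<inter> D \<inter> args F \<subseteq> Q"
  shows "scc F a = Q"
proof
  show "Q \<subseteq> scc F a" using assms(1-4) by (auto simp: scc_def)
  show "scc F a \<subseteq> Q"
  proof
    fix b assume "b \<in> scc F a"
    then have b: "b \<in> args F" "(a, b) \<in> (atts F)\<^sup>*" "(b, a) \<in> (atts F)\<^sup>*"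
      by (auto simp: scc_def)
    have "b \<in> U" by (rule rtrancl_closed[OF b(2) assms(5) assms(6)])
    moreover have "b \<in> D" by (rule rtrancl_backward_closed[OF b(3) assms(7) assms(8)])
    ultimately show "b \<in> Q" using b(1) assms(9) by blast
  qed
qed

text \<open>A value of the sequence that contains \<open>a\<close> and is fixed by the successor step is below every
  other value, since it is strongly connected and never hit by a deletion.\<close>

lemma fixed_stage_least:
  assumes fixed: "Cstep F S a P = P" and P: "a \<in> P" and X: "X \<in> Ctower F S a"
  shows "P \<subseteq> X"
proof -
  \<comment> \<open>A component taken in \<open>P - Dset F S P\<close> equals \<open>P\<close> only
    if nothing was removed.\<close>
  have D: "Dset F S P = {}"
    using fixed scc_subset_args[of "restrict F (P - Dset F S P)" a]
    by (auto simp: Cstep_def Dset_def)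
  then have con: "scc (restrict F P) a = P" using fixed by (simp add: Cstep_def)
  have sub: "P \<subseteq> scc (restrict F Y) a" if "P \<subseteq> Y" for Y
    using scc_mono[of "restrict F P" "restrict F Y" a] that con by auto
  show ?thesis using X
  proof induction
    case base
    show ?case using scc_mono[of "restrict F P" F a] con by auto
  next
    case (succ X)
    \<comment> \<open>A member of \<open>S\<close> outside \<open>X\<close> is also outside
      \<open>P\<close>; if it attacked \<open>P\<close>, its target would lie in
      \<open>Dset F S P\<close>.\<close>
    have "P \<subseteq> X - Dset F S X" using succ.IH D by (auto simp: Dset_def)
    then show ?case unfolding Cstep_def by (rule sub)
  next
    case (lim Y)
    have "P \<subseteq> \<Inter>Y" using lim by blast
    then show ?case by (rule sub)
  qed
qed

text \<open>Replaces ordinal bookkeeping: any stopping value contains \<open>P\<close>, hence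
  \<open>a\<close>, so it is fixed as well, and two fixed values containing \<open>a\<close> lie
  below each other.\<close>

lemma Cfinal_eqI:
  assumes "P \<in> Ctower F S a" "a \<in> P" "Cstep F S a P = P"
  shows "Cfinal F S a = P"
proof -
  have le: "Y = P" if "Y \<in> Ctower F S a" "a \<notin> Y \<or> Cstep F S a Y = Y" for Y
  proof
    show "P \<subseteq> Y" by (rule fixed_stage_least[OF assms(3,2) that(1)])
    then have "a \<in> Y" using assms(2) by blast
    then show "Y \<subseteq> P" using fixed_stage_least[of F S a Y P] that(2) assms(1) by blast
  qed
  show ?thesis
    unfolding Cfinal_def using assms le by (intro the_equality) blast+
qed

section \<open>Renaming arguments\<close>

text \<open>Serves twice: \<open>Pair j\<close> embeds a level into the whole framework, and an
  injection into \<open>nat\<close> moves the framework to the type in the theorem.\<close>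

definition rename :: "('a \<Rightarrow> 'b) \<Rightarrow> 'a AF \<Rightarrow> 'b AF" where
  "rename f F = (f ` args F, map_prod f f ` atts F)"

lemma args_rename [simp]: "args (rename f F) = f ` args F"
  by (simp add: rename_def args_def)

lemma atts_rename [simp]: "atts (rename f F) = map_prod f f ` atts F"
  by (simp add: rename_def atts_def)

lemma atts_rename_iff:
  assumes "inj f"
  shows "(f x, f y) \<in> map_prod f f ` r \<longleftrightarrow> (x, y) \<in> r"
  by (auto simp: inj_eq[OF assms] intro: map_prod_imageI)

lemma AF_eqI: "args F = args G \<Longrightarrow> atts F = atts G \<Longrightarrow> F = G"
  by (simp add: args_def atts_def prod_eq_iff)

lemma restrict_rename:
  assumes "inj f"
  shows "restrict (rename f F) (f ` X) = rename f (restrict F X)"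
  by (rule AF_eqI) (auto simp: inj_eq[OF assms] image_iff)

lemma rtrancl_map_prod:
  assumes "inj f"
  shows "(f x, f y) \<in> (map_prod f f ` r)\<^sup>* \<longleftrightarrow> (x, y) \<in> r\<^sup>*"
proof
  \<comment> \<open>A path starting in the image of \<open>f\<close> never leaves it, so it lifts
    edge by edge.\<close>
  have "\<exists>y. v = f y \<and> (x, y) \<in> r\<^sup>*" if "(f x, v) \<in> (map_prod f f ` r)\<^sup>*" for v
    using that
  proof (induction rule: rtrancl_induct)
    case (step v w)
    then obtain y z z' where "v = f y" "(x, y) \<in> r\<^sup>*" "v = f z" "w = f z'" "(z, z') \<in> r" by auto
    then show ?case using inj_eq[OF assms] by (metis rtrancl.rtrancl_into_rtrancl)
  qed auto
  then show "(x, y) \<in> r\<^sup>*" if "(f x, f y) \<in> (map_prod f f ` r)\<^sup>*"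
    using that inj_eq[OF assms] by metis
  show "(f x, f y) \<in> (map_prod f f ` r)\<^sup>*" if "(x, y) \<in> r\<^sup>*"
    using that
    by (induction rule: rtrancl_induct) (auto intro: rtrancl_into_rtrancl map_prod_imageI)
qed

lemma scc_rename:
  assumes "inj f"
  shows "scc (rename f F) (f a) = f ` scc F a"
  by (auto simp: scc_def rtrancl_map_prod[OF assms] inj_eq[OF assms] image_iff)

lemma Dset_rename:
  assumes "inj f"
  shows "Dset (rename f F) (f ` S) (f ` X) = f ` Dset F S X"
  unfolding Dset_def using assms
  by (auto simp: inj_image_mem_iff dest!: injD[OF assms] simp flip: image_set_diff)

lemma Cstep_rename:
  assumes "inj f"
  shows "Cstep (rename f F) (f ` S) (f a) (f ` X) = f ` Cstep F S a X"
  by (simp add: Cstep_def Dset_rename[OF assms] restrict_rename[OF assms] scc_rename[OF assms]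
      flip: image_set_diff[OF assms])

lemma Ctower_rename:
  assumes f: "inj f" and "X \<in> Ctower F S a"
  shows "f ` X \<in> Ctower (rename f F) (f ` S) (f a)"
  using assms(2)
proof induction
  case base
  show ?case by (metis Ctower.base scc_rename[OF f])
next
  case (succ X)
  then show ?case by (metis Ctower.succ Cstep_rename[OF f])
next
  case (lim Y)
  \<comment> \<open>Nonemptiness matters: for the empty family the left side would be
    \<open>UNIV\<close> and the right side \<open>range f\<close>.\<close>
  have "\<Inter>((`) f ` Y) = f ` \<Inter>Y"
    using lim.hyps(1) image_INT[of f UNIV Y id] f by auto
  then have "f ` scc (restrict F (\<Inter>Y)) a = scc (restrict (rename f F) (\<Inter>((`) f ` Y))) (f a)"
    by (simp only: scc_rename[OF f] restrict_rename[OF f])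
  moreover have "\<dots> \<in> Ctower (rename f F) (f ` S) (f a)"
    using lim by (intro Ctower.lim) auto
  ultimately show ?case by simp
qed

lemma conflict_free_rename:
  assumes "inj f"
  shows "conflict_free (rename f F) (f ` S) \<longleftrightarrow> conflict_free F S"
  by (simp add: conflict_free_def inj_image_subset_iff[OF assms] atts_rename_iff[OF assms])

lemma range_plus_rename:
  assumes "inj f"
  shows "range_plus (rename f F) (f ` S) = f ` range_plus F S"
  unfolding range_plus_def by (auto dest!: injD[OF assms])

lemma stage_ext_rename:
  assumes "inj f" "stage_ext (rename f F) (f ` S)"
  shows "stage_ext F S"
  unfolding stage_ext_def
proof (intro conjI notI)
  show "conflict_free F S"
    using assms by (simp add: stage_ext_def conflict_free_rename)
  assume "\<exists>T. conflict_free F T \<and> range_plus F S \<subset> range_plus F T"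
  then obtain T where "conflict_free F T" "range_plus F S \<subset> range_plus F T" by blast
  then have "conflict_free (rename f F) (f ` T)"
    "range_plus (rename f F) (f ` S) \<subset> range_plus (rename f F) (f ` T)"
    using assms(1) by (auto simp: conflict_free_rename range_plus_rename inj_image_subset_iff
        psubset_eq inj_image_eq_iff)
  then show False using assms(2) unfolding stage_ext_def by blast
qed

text \<open>Pulls membership in \<open>tfstg2\<close> back to the original framework, phrased with
  fixed values instead of \<open>Cfinal\<close>.\<close>

lemma tfstg2_rename_stage:
  assumes f: "inj f" and S: "f ` S \<in> tfstg2 (rename f F)" and a: "a \<in> args F"
    and P: "P \<in> Ctower F S a" "a \<in> P" "Cstep F S a P = P"
  shows "stage_ext (restrict F P) (S \<inter> P)"
proof -
  have "Cfinal (rename f F) (f ` S) (f a) = f ` P"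
    using P by (intro Cfinal_eqI) (auto simp: Cstep_rename[OF f] intro: Ctower_rename[OF f])
  then have "stage_ext (restrict (rename f F) (f ` P)) (f ` S \<inter> f ` P)"
    using S a P(2) unfolding tfstg2_def by force
  then have "stage_ext (rename f (restrict F P)) (f ` (S \<inter> P))"
    by (simp only: restrict_rename[OF f] image_Int[OF f])
  then show ?thesis by (rule stage_ext_rename[OF f])
qed

lemma finitary_rename:
  assumes "inj f" "finitary F"
  shows "finitary (rename f F)"
  unfolding finitary_def
proof
  fix c assume "c \<in> args (rename f F)"
  then obtain b where b: "c = f b" "b \<in> args F" by auto
  have "{a. (a, c) \<in> atts (rename f F)} = f ` {a. (a, b) \<in> atts F}"
    by (auto simp: b inj_eq[OF assms(1)])
  then show "finite {a. (a, c) \<in> atts (rename f F)}"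
    using assms(2) b(2) by (simp add: finitary_def)
qed

lemma wf_AF_rename: "wf_AF F \<Longrightarrow> wf_AF (rename f F)"
  by (auto simp: wf_AF_def)

section \<open>The framework\<close>

text \<open>\<open>H\<close>, \<open>G\<close>, \<open>K\<close> and \<open>L\<close> attack
  themselves, so they are never accepted and only matter for ranges and paths. \<open>C t\<close>
  rules out both \<open>P (\<not> t) s\<close>. The chain of the \<open>L i\<close> down to
  \<open>L 0\<close>, which attacks \<open>C True\<close>, lets infinitely many \<open>K i\<close>
  reach \<open>C True\<close> while keeping its attackers finite in number.\<close>

datatype node = C bool | P bool bool | H bool | G bool | K nat | L nat

instance node :: countable
  by countable_datatype

fun inner :: "node \<Rightarrow> node \<Rightarrow> bool" where
  "inner (C t) (C t') \<longleftrightarrow> t' \<noteq> t"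
| "inner (C t) (P t' s) \<longleftrightarrow> t' \<noteq> t"
| "inner (P t s) (P t' s') \<longleftrightarrow> t' \<noteq> t \<or> s' \<noteq> s"
| "inner (P t s) (H s') \<longleftrightarrow> s' = s"
| "inner (P t s) (G t') \<longleftrightarrow> t' = t \<and> s \<noteq> t"
| "inner (H s) (H s') \<longleftrightarrow> s' = s"
| "inner (H s) (P t' s') \<longleftrightarrow> t' = s \<and> s' = s"
| "inner (G t) (G t') \<longleftrightarrow> t' = t"
| "inner (G t) (K i) \<longleftrightarrow> True"
| "inner (K i) (K i') \<longleftrightarrow> i' = i"
| "inner (K i) (L i') \<longleftrightarrow> i' = i"
| "inner (L i) (L i') \<longleftrightarrow> i' = i \<or> i = Suc i'"
| "inner (L i) (C t) \<longleftrightarrow> i = 0 \<and> t"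
| "inner _ _ \<longleftrightarrow> False"

definition level_AF :: "node AF" where
  "level_AF = (UNIV, {(x, y). inner x y})"

text \<open>Level \<open>m > j\<close> attacks only the connector \<open>K (m - j - 1)\<close> of
  level \<open>j\<close>. Thus infinitely many levels influence level \<open>j\<close>, yet each
  connector has just two attackers from outside.\<close>

definition yablo_AF :: "(nat \<times> node) AF" where
  "yablo_AF = (UNIV, {((j, x), (j, y)) | j x y. inner x y} \<union>
     {((j + Suc i, P t (\<not> t)), (j, K i)) | j i t. True})"

lemma args_level_AF [simp]: "args level_AF = UNIV"
  by (simp add: level_AF_def args_def)

lemma atts_level_AF [simp]: "(x, y) \<in> atts level_AF \<longleftrightarrow> inner x y"
  by (simp add: level_AF_def atts_def)

lemma wf_level_AF: "wf_AF level_AF"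
  by (simp add: wf_AF_def)

lemma args_yablo_AF [simp]: "args yablo_AF = UNIV"
  by (simp add: yablo_AF_def args_def)

lemma atts_yablo_AF [simp]: "((m, x), (j, y)) \<in> atts yablo_AF \<longleftrightarrow>
    m = j \<and> inner x y \<or> (\<exists>i t. m = j + Suc i \<and> x = P t (\<not> t) \<and> y = K i)"
  by (auto simp: yablo_AF_def atts_def)

lemma finitary_yablo_AF: "finitary yablo_AF"
  unfolding finitary_def
proof
  fix b :: "nat \<times> node"
  obtain j y where b: "b = (j, y)" by (cases b)
  define N where "N = C ` UNIV \<union> range (\<lambda>(t, s). P t s) \<union> H ` UNIV \<union> G ` UNIV"
  \<comment> \<open>The default 0 covers \<open>C True\<close>, attacked by \<open>L 0\<close>; the
    bound \<open>Suc I\<close> below is due to \<open>L (Suc i)\<close> attacking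
    \<open>L i\<close>.\<close>
  define I where "I = (case y of K i \<Rightarrow> i | L i \<Rightarrow> i | _ \<Rightarrow> 0)"
  have "x \<in> N \<union> K ` {..I} \<union> L ` {..Suc I}" if "inner x y" for x
    using that by (cases x; cases y) (auto simp: N_def I_def)
  moreover have "P t s \<in> N" for t s
    by (auto simp: N_def)
  ultimately have "{a. (a, b) \<in> atts yablo_AF} \<subseteq>
      {..j + Suc I} \<times> (N \<union> K ` {..I} \<union> L ` {..Suc I})"
    by (force simp: b I_def)
  moreover have "finite N" by (simp add: N_def)
  ultimately show "finite {a. (a, b) \<in> atts yablo_AF}"
    by (meson finite_SigmaI finite_UnI finite_atMost finite_imageI finite_subset)
qed

lemma restrict_yablo_AF: "restrict yablo_AF (Pair j ` Y) = rename (Pair j) (restrict level_AF Y)"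
  by (rule AF_eqI) (auto simp: image_iff)

lemma inj_Pair: "inj (Pair j)"
  by (simp add: inj_on_def)

subsection \<open>Reachability inside a level\<close>

definition steps :: "node set \<Rightarrow> (node \<times> node) set" where
  "steps Y = (atts (restrict level_AF Y))\<^sup>*"

lemma steps_trans [trans]: "(x, y) \<in> steps Y \<Longrightarrow> (y, z) \<in> steps Y \<Longrightarrow> (x, z) \<in> steps Y"
  unfolding steps_def by (rule rtrancl_trans)

lemma steps_refl [simp]: "(x, x) \<in> steps Y"
  by (simp add: steps_def)

lemma step: "inner x y \<Longrightarrow> x \<in> Y \<Longrightarrow> y \<in> Y \<Longrightarrow> (x, y) \<in> steps Y"
  unfolding steps_def by (rule r_into_rtrancl) simp

lemma steps_L:
  assumes "range L \<subseteq> Y" "C True \<in> Y"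
  shows "(L i, C True) \<in> steps Y"
proof (induction i)
  case 0
  show ?case using assms by (intro step) auto
next
  case (Suc i)
  have "(L (Suc i), L i) \<in> steps Y" using assms by (intro step) auto
  then show ?case using Suc by (rule steps_trans)
qed

text \<open>With all \<open>L i\<close> present, a single \<open>K i\<close> keeps this part in one
  component.\<close>

definition core :: "node set" where
  "core = - (range K \<union> range L)"

lemma core_simps [simp]:
  "C t \<in> core" "P t s \<in> core" "H s \<in> core" "G t \<in> core" "K i \<notin> core" "L i \<notin> core"
  by (auto simp: core_def)

lemma steps_from_C:
  assumes "core \<subseteq> Y" "x \<in> core"
  shows "(C True, x) \<in> steps Y"
proof -
  have C: "(C True, C t) \<in> steps Y" for t
    using assms(1) by (cases t) (auto intro!: step)
  have P: "(C True, P t s) \<in> steps Y" for t s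
    using C[of "\<not> t"] assms(1) by (rule_tac steps_trans) (auto intro!: step)
  have H: "(C True, H s) \<in> steps Y" for s
    using P[of s s] assms(1) by (rule_tac steps_trans) (auto intro!: step)
  have G: "(C True, G t) \<in> steps Y" for t
    using P[of t "\<not> t"] assms(1) by (rule_tac steps_trans) (auto intro!: step)
  show ?thesis using assms(2) C P H G by (cases x) auto
qed

text \<open>Every argument of the core leads to some \<open>G t\<close>, and from there the path
  runs through \<open>K i\<close>, \<open>L i\<close> and the chain down to
  \<open>L 0\<close>.\<close>

lemma steps_to_C:
  assumes "core \<subseteq> Y" "range L \<subseteq> Y" "K i \<in> Y" "x \<in> core"
  shows "(x, C True) \<in> steps Y"
proof -
  have "(G t, K i) \<in> steps Y" "(K i, L i) \<in> steps Y" for t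
    using assms by (auto intro!: step)
  then have G: "(G t, C True) \<in> steps Y" for t
    using steps_L[of Y i] assms by (meson core_simps(1) steps_trans subsetD)
  have "(P t (\<not> t), G t) \<in> steps Y" "(P t t, P t (\<not> t)) \<in> steps Y" for t
    using assms by (auto intro!: step)
  then have P': "(P t (\<not> t), C True) \<in> steps Y" "(P t t, C True) \<in> steps Y" for t
    using G by (meson steps_trans)+
  then have P: "(P t s, C True) \<in> steps Y" for t s
    by (metis (full_types))
  have "(H s, P s s) \<in> steps Y" "(C t, P (\<not> t) s) \<in> steps Y" for s t
    using assms by (auto intro!: step)
  then have "(H s, C True) \<in> steps Y" "(C t, C True) \<in> steps Y" for s t
    using P by (meson steps_trans)+
  then show ?thesis using assms(4) P G by (cases x) auto
qed

lemma steps_UNIV: "(x, y) \<in> steps UNIV"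
proof -
  have K: "(K i, L i) \<in> steps UNIV" "(G True, K i) \<in> steps UNIV" for i
    by (auto intro!: step)
  have "(x, C True) \<in> steps UNIV"
    using steps_to_C[of UNIV 0 x] steps_L[of UNIV] K(1)
    by (cases x) (auto intro: steps_trans)
  moreover have "(C True, G True) \<in> steps UNIV" by (rule steps_from_C) auto
  then have "(C True, K i) \<in> steps UNIV" "(C True, L i) \<in> steps UNIV" for i
    using K by (meson steps_trans)+
  then have "(C True, y) \<in> steps UNIV"
    using steps_from_C[of UNIV y] by (cases y) auto
  ultimately show ?thesis by (rule steps_trans)
qed

lemma yablo_level_mono:
  assumes "(u, v) \<in> (atts yablo_AF)\<^sup>*"
  shows "fst v \<le> fst u"
  using assms
proof (induction rule: rtrancl_induct)
  case (step v w)
  then show ?case by (cases v; cases w) auto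
qed simp

lemma scc_yablo_AF: "scc yablo_AF (j, x) = Pair j ` UNIV"
proof
  show "scc yablo_AF (j, x) \<subseteq> Pair j ` UNIV"
    by (force simp: scc_def dest: yablo_level_mono)
  have "scc (restrict yablo_AF (Pair j ` UNIV)) (j, x) = Pair j ` scc (restrict level_AF UNIV) x"
    using scc_rename[OF inj_Pair] by (simp add: restrict_yablo_AF)
  also have "\<dots> = Pair j ` UNIV"
    using steps_UNIV by (auto simp: scc_def steps_def)
  finally show "Pair j ` UNIV \<subseteq> scc yablo_AF (j, x)"
    using scc_mono[of "restrict yablo_AF (Pair j ` UNIV)" yablo_AF "(j, x)"] by auto
qed


subsection \<open>Extensions of the framework\<close>

text \<open>What an extension in \<open>tfstg2\<close> would provide, collected in order to be
  refuted.\<close>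

locale yablo_ext =
  fixes S :: "(nat \<times> node) set"
  assumes cf: "conflict_free yablo_AF S"
    and stage: "\<And>a X. X \<in> Ctower yablo_AF S a \<Longrightarrow> a \<in> X \<Longrightarrow> Cstep yablo_AF S a X = X \<Longrightarrow>
      stage_ext (restrict yablo_AF X) (S \<inter> X)"
begin

definition accepted :: "nat \<Rightarrow> node set" where
  "accepted j = {x. (j, x) \<in> S}"

definition crossed :: "nat \<Rightarrow> bool" where
  "crossed j \<longleftrightarrow> (\<exists>t. P t (\<not> t) \<in> accepted j)"

text \<open>\<open>Dset\<close> seen from level \<open>j\<close>: attacks come from the same level
  outside \<open>X\<close>, or from higher levels, and the latter reach connectors only.\<close>

definition hit :: "nat \<Rightarrow> node set \<Rightarrow> node set" where
  "hit j X = {y \<in> X. (\<exists>x \<in> accepted j - X. inner x y) \<or> (\<exists>i. y = K i \<and> crossed (j + Suc i))}"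

lemma inner_conflict: "inner x y \<Longrightarrow> x \<in> accepted j \<Longrightarrow> y \<notin> accepted j"
  using cf by (force simp: conflict_free_def accepted_def)

lemma not_accepted [simp]:
  "H s \<notin> accepted j" "G t \<notin> accepted j" "K i \<notin> accepted j" "L i \<notin> accepted j"
  using inner_conflict by force+

lemma Dset_level: "Dset yablo_AF S (Pair j ` X) = Pair j ` hit j X"
  by (auto simp: Dset_def hit_def accepted_def crossed_def image_iff Bex_def) fastforce+

lemma Cstep_level:
  "Cstep yablo_AF S (j, x) (Pair j ` X) = Pair j ` scc (restrict level_AF (X - hit j X)) x"
  using scc_rename[OF inj_Pair, of j "restrict level_AF (X - hit j X)" x]
  by (simp add: Cstep_def Dset_level restrict_yablo_AF flip: image_set_diff[OF inj_Pair])

text \<open>The value at index 1. The initial component is the whole level, so the first deletion is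
  due to higher levels alone.\<close>

lemma first_stage:
  "Pair j ` scc (restrict level_AF (- {K i | i. crossed (j + Suc i)})) x \<in> Ctower yablo_AF S (j, x)"
proof -
  have "Pair j ` UNIV \<in> Ctower yablo_AF S (j, x)"
    using Ctower.base[of yablo_AF "(j, x)" S] by (simp add: scc_yablo_AF)
  then have "Cstep yablo_AF S (j, x) (Pair j ` UNIV) \<in> Ctower yablo_AF S (j, x)"
    by (rule Ctower.succ)
  moreover have "UNIV - hit j UNIV = - {K i | i. crossed (j + Suc i)}"
    by (auto simp: hit_def)
  ultimately show ?thesis by (simp only: Cstep_level)
qed

lemma stage_level:
  assumes "Pair j ` X \<in> Ctower yablo_AF S (j, x)" "x \<in> X"
    and "scc (restrict level_AF X) x = X" "hit j X = {}"
  shows "stage_ext (restrict level_AF X) (accepted j \<inter> X)"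
proof -
  have "stage_ext (restrict yablo_AF (Pair j ` X)) (S \<inter> Pair j ` X)"
    using assms by (intro stage[of _ "(j, x)"]) (auto simp: Cstep_level)
  moreover have "S \<inter> Pair j ` X = Pair j ` (accepted j \<inter> X)"
    by (auto simp: accepted_def)
  ultimately have "stage_ext (rename (Pair j) (restrict level_AF X)) (Pair j ` (accepted j \<inter> X))"
    by (simp only: restrict_yablo_AF)
  then show ?thesis by (rule stage_ext_rename[OF inj_Pair])
qed

section \<open>Truth conditions for a crossed level\<close>

lemma crossed_if_connected:
  assumes i: "\<not> crossed (j + Suc i)"
  shows "crossed j"
proof (rule ccontr)
  assume not_crossed: "\<not> crossed j"
  define Y where "Y = - {K i | i. crossed (j + Suc i)}"
  define Z where "Z = scc (restrict level_AF Y) (C True)"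
  have Y: "core \<subseteq> Y" "range L \<subseteq> Y" "K i \<in> Y"
    using i by (auto simp: Y_def)
  have core: "core \<subseteq> Z"
    using Y steps_from_C[OF Y(1)] steps_to_C[OF Y] by (auto simp: Z_def scc_def steps_def)
  have "Z \<subseteq> Y" using scc_subset_args[of "restrict level_AF Y" "C True"] by (auto simp: Z_def)
  then have "hit j Z = {}"
  proof -
    \<comment> \<open>Accepted arguments of the level have the form \<open>C t\<close> or
      \<open>P t s\<close>, so none is outside \<open>Z\<close>, and the sequence stops at
      \<open>Z\<close>.\<close>
    have "x \<in> Z" if "x \<in> accepted j" for x
      using that core by (cases x) auto
    then show ?thesis using \<open>Z \<subseteq> Y\<close> by (auto simp: hit_def Y_def)
  qed
  moreover have "scc (restrict level_AF Z) (C True) = Z"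
    by (rule scc_restrict_idem[OF wf_level_AF Z_def])
  moreover have "Pair j ` Z \<in> Ctower yablo_AF S (j, C True)"
    using first_stage by (simp add: Z_def Y_def)
  ultimately have st: "stage_ext (restrict level_AF Z) (accepted j \<inter> Z)"
    using core by (intro stage_level) auto
  have inZ: "C t \<in> Z" "P t s \<in> Z" "H s \<in> Z" "G t \<in> Z" for t s
    using core by auto
  let ?R = "range_plus (restrict level_AF Z)"
  have better: False
    if "conflict_free (restrict level_AF Z) T" "?R (accepted j \<inter> Z) \<subseteq> ?R T"
      "y \<in> ?R T" "y \<notin> ?R (accepted j \<inter> Z)" for T y
    using st that unfolding stage_ext_def by blast
  show False
  proof (cases "\<exists>t. P t t \<in> accepted j")
    case True
    then obtain t where t: "P t t \<in> accepted j" by blast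
    have acc: "x = P t t \<or> x = C t" if "x \<in> accepted j" for x
      using that t inner_conflict[of x "P t t" j] by (cases x; cases t) (auto, metis (full_types))
    show False
    proof (rule better)
      \<comment> \<open>Keeping the second index \<open>t\<close> keeps \<open>H t\<close> in the
        range; flipping the first one gives a crossing, which gains
        \<open>G (\<not> t)\<close>.\<close>
      show "conflict_free (restrict level_AF Z) {C (\<not> t), P (\<not> t) t}"
        using inZ by (auto simp: conflict_free_def)
      show "?R (accepted j \<inter> Z) \<subseteq> ?R {C (\<not> t), P (\<not> t) t}"
      proof
        fix y assume "y \<in> ?R (accepted j \<inter> Z)"
        then show "y \<in> ?R {C (\<not> t), P (\<not> t) t}"
          using inZ by (cases y) (auto simp: range_plus_def dest!: acc)
      qed
      show "G (\<not> t) \<in> ?R {C (\<not> t), P (\<not> t) t}"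
        using inZ by (auto simp: range_plus_def)
      show "G (\<not> t) \<notin> ?R (accepted j \<inter> Z)"
        by (auto simp: range_plus_def dest!: acc)
    qed
  next
    case False
    have P: "P t s \<notin> accepted j" for t s
      using False not_crossed unfolding crossed_def by (cases t; cases s) (auto simp: ex_bool_eq)
    obtain u where acc: "\<And>x. x \<in> accepted j \<Longrightarrow> x = C u"
    proof (cases "\<exists>u. C u \<in> accepted j")
      case True
      then obtain u where u: "C u \<in> accepted j" by blast
      have "x = C u" if "x \<in> accepted j" for x
        using that P inner_conflict[of x "C u" j] u
        by (cases x; cases u) (auto, metis (full_types))
      then show ?thesis using that by blast
    next
      case False
      \<comment> \<open>Nothing is accepted in level \<open>j\<close> here, so \<open>True\<close>
        is an arbitrary choice.\<close>
      have "x = C True" if "x \<in> accepted j" for x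
        using that P False by (cases x) auto
      then show ?thesis using that by blast
    qed
    show False
    proof (rule better)
      show "conflict_free (restrict level_AF Z) {C u, P u u}"
        using inZ by (auto simp: conflict_free_def)
      show "?R (accepted j \<inter> Z) \<subseteq> ?R {C u, P u u}"
        by (auto simp: range_plus_def dest!: acc)
      show "P u u \<in> ?R {C u, P u u}"
        by (auto simp: range_plus_def)
      show "P u u \<notin> ?R (accepted j \<inter> Z)"
        by (auto simp: range_plus_def dest!: acc)
    qed
  qed
qed

text \<open>The sequence is followed for one step at \<open>C True\<close>, which yields the index
  \<open>u\<close>, and then for two steps at \<open>P u u\<close>.\<close>

lemma not_crossed_if_disconnected:
  assumes "\<And>i. crossed (j + Suc i)"
  shows "\<not> crossed j"
proof -
  define Y where "Y = - range K"
  have Y: "- {K i | i. crossed (j + Suc i)} = Y"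
    using assms by (auto simp: Y_def)
  have K: "K i \<notin> Y" "C t \<in> Y" "P t s \<in> Y" "H s \<in> Y" for i t s
    by (auto simp: Y_def)

  \<comment> \<open>Without connectors, the \<open>L i\<close> are attacked only by one another, and
    every path into a \<open>C t\<close> starts in some \<open>C\<close> or
    \<open>L\<close>.\<close>
  have sccC: "scc (restrict level_AF Y) (C True) = range C"
  proof (rule scc_eqI[where U = "- range L" and D = "range C \<union> range L"])
    show "(C True, x) \<in> (atts (restrict level_AF Y))\<^sup>*" if "x \<in> range C" for x
      using that step[of "C True" "C False" Y] K unfolding steps_def 
      by (auto, metis (full_types) rtrancl.rtrancl_refl)
    show "(x, C True) \<in> (atts (restrict level_AF Y))\<^sup>*" if "x \<in> range C" for x
      using that step[of "C False" "C True" Y] K unfolding steps_def 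
      by (auto, metis (full_types) rtrancl.rtrancl_refl)
    show "y \<in> - range L" if "(x, y) \<in> atts (restrict level_AF Y)" "x \<in> - range L" for x y
      using that K by (cases x; cases y) auto
    show "x \<in> range C \<union> range L"
      if "(x, y) \<in> atts (restrict level_AF Y)" "y \<in> range C \<union> range L" for x y
      using that K by (cases x; cases y) auto
  qed (auto simp: Y_def)
  have "stage_ext (restrict level_AF (range C)) (accepted j \<inter> range C)"
  proof (rule stage_level)
    show "Pair j ` range C \<in> Ctower yablo_AF S (j, C True)"
      using first_stage[of j "C True"] unfolding Y sccC .
    show "scc (restrict level_AF (range C)) (C True) = range C"
      by (rule scc_restrict_idem[OF wf_level_AF sccC[symmetric]])
    \<comment> \<open>From outside \<open>range C\<close> only \<open>L 0\<close> attacks some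
      \<open>C t\<close>, and it is never accepted.\<close>
    have "\<not> inner x (C t)" if "x \<in> accepted j - range C" for x t
      using that by (cases x) auto
    then show "hit j (range C) = {}" by (auto simp: hit_def)
  qed auto
  then have "accepted j \<inter> range C \<noteq> {}"
  proof (rule contrapos_pn)
    assume "accepted j \<inter> range C = {}"
    moreover have "conflict_free (restrict level_AF (range C)) {C True}"
      by (auto simp: conflict_free_def)
    ultimately show "\<not> stage_ext (restrict level_AF (range C)) (accepted j \<inter> range C)"
      unfolding stage_ext_def range_plus_def by blast
  qed
  then obtain u where u: "C u \<in> accepted j" by blast
  have nC: "C (\<not> u) \<notin> accepted j" and nP: "P (\<not> u) s \<notin> accepted j" for s
    using inner_conflict[OF _ u] by auto

  \<comment> \<open>With the connectors gone, each \<open>G t\<close> reaches only itself, and no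
    path leads from a \<open>P\<close> or an \<open>H\<close> back to a \<open>C\<close>.\<close>
  define R where "R = {x. \<exists>t s. x = P t s \<or> x = H s}"
  have R: "P t s \<in> R" "H s \<in> R" "C t \<notin> R" "G t \<notin> R" "K i \<notin> R" "L i \<notin> R" for t s i
    by (auto simp: R_def)
  have sccR: "scc (restrict level_AF Y) (P u u) = R"
  proof (rule scc_eqI[where U = "R \<union> range G" and D = "- range G"])
    have PP: "(P t s, P t' s') \<in> steps Y" for t s t' s'
      using step[of "P t s" "P t' s'" Y] K by (cases "t = t' \<and> s = s'") auto
    moreover have "(P s s, H s) \<in> steps Y" "(H s, P s s) \<in> steps Y" for s
      using K by (auto intro!: step)
    ultimately have PH: "(P u u, H s) \<in> steps Y" "(H s, P u u) \<in> steps Y" for s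
      by (meson steps_trans)+
    show "(P u u, x) \<in> (atts (restrict level_AF Y))\<^sup>*" if "x \<in> R" for x
      using that PP PH unfolding steps_def by (cases x) (auto simp: R)
    show "(x, P u u) \<in> (atts (restrict level_AF Y))\<^sup>*" if "x \<in> R" for x
      using that PP PH unfolding steps_def by (cases x) (auto simp: R)
    show "y \<in> R \<union> range G" if "(x, y) \<in> atts (restrict level_AF Y)" "x \<in> R \<union> range G" for x y
      using that K by (cases x; cases y) (auto simp: R)
    show "x \<in> - range G" if "(x, y) \<in> atts (restrict level_AF Y)" "y \<in> - range G" for x y
      using that K by (cases x; cases y) auto
  qed (auto simp: Y_def R_def)
  \<comment> \<open>\<open>C u\<close> is the only accepted argument of the level outside
    \<open>R\<close>, and it deletes both \<open>P (\<not> u) s\<close>.\<close>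
  define Y' where "Y' = {P u True, P u False, H True, H False}"
  have Y': "R - hit j R = Y'"
  proof -
    have "hit j R = {P (\<not> u) True, P (\<not> u) False}"
    proof -
      have attack: "inner x y \<longleftrightarrow> y \<in> range (P (\<not> u))" if "x \<in> accepted j - R" "y \<in> R" for x y
        using that nC by (cases x; cases y) (auto simp: R)
      have "C u \<in> accepted j - R" using u R by auto
      then have hits: "(\<exists>x \<in> accepted j - R. inner x y) \<longleftrightarrow> y \<in> range (P (\<not> u))" if "y \<in> R" for y
        using attack[OF _ that] by meson
      have not_K: "y \<noteq> K i" if "y \<in> R" for y i
        using that R(5) by metis
      have "y \<in> hit j R \<longleftrightarrow> y \<in> R \<inter> range (P (\<not> u))" for y
        by (cases "y \<in> R") (simp_all add: hit_def hits not_K)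
      then have "hit j R = R \<inter> range (P (\<not> u))" by (rule set_eqI)
      then show ?thesis by (auto simp: R UNIV_bool)
    qed
    then show ?thesis by (auto simp: Y'_def R_def)
  qed
  \<comment> \<open>\<open>H (\<not> u)\<close> drops out: its only target besides itself,
    \<open>P (\<not> u) (\<not> u)\<close>, has been deleted.\<close>
  define Q where "Q = {P u True, P u False, H u}"
  have Q: "P u s \<in> Q" "H u \<in> Q" for s by (cases s; simp add: Q_def)+
  have Y'Q: "Q \<subseteq> Y'" by (auto simp: Q_def Y'_def)
  have sccQ: "scc (restrict level_AF Y') (P u u) = Q"
  proof (rule scc_eqI[where U = UNIV and D = Q])
    have "(P u u, P u s) \<in> steps Y'" "(P u s, P u u) \<in> steps Y'" for s
      using step[of "P u u" "P u s" Y'] step[of "P u s" "P u u" Y'] Q Y'Q by (cases "s = u"; auto)+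
    moreover have "(P u u, H u) \<in> steps Y'" "(H u, P u u) \<in> steps Y'"
      using Q Y'Q by (auto intro!: step)
    ultimately show "(P u u, x) \<in> (atts (restrict level_AF Y'))\<^sup>*"
      "(x, P u u) \<in> (atts (restrict level_AF Y'))\<^sup>*" if "x \<in> Q" for x
      using that unfolding steps_def Q_def by blast+
    show "x \<in> Q" if "(x, y) \<in> atts (restrict level_AF Y')" "y \<in> Q" for x y
      using that by (auto simp: Q_def Y'_def)
  qed (use Q Y'Q in auto)
  have st: "stage_ext (restrict level_AF Q) (accepted j \<inter> Q)"
  proof (rule stage_level)
    have "Pair j ` R \<in> Ctower yablo_AF S (j, P u u)"
      using first_stage[of j "P u u"] unfolding Y sccR .
    then have "Cstep yablo_AF S (j, P u u) (Pair j ` R) \<in> Ctower yablo_AF S (j, P u u)"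
      by (rule Ctower.succ)
    then show "Pair j ` Q \<in> Ctower yablo_AF S (j, P u u)"
      by (simp only: Cstep_level Y' sccQ)
    show "scc (restrict level_AF Q) (P u u) = Q"
      by (rule scc_restrict_idem[OF wf_level_AF sccQ[symmetric]])
    \<comment> \<open>The only accepted argument of the level outside \<open>Q\<close> is
      \<open>C u\<close>, which attacks nothing in \<open>Q\<close>.\<close>
    have "\<not> inner x y" if "x \<in> accepted j - Q" "y \<in> Q" for x y
    proof (cases x)
      case (C t)
      then have "t = u" using that nC by (cases t; cases u) auto
      then show ?thesis using C that(2) by (auto simp: Q_def)
    next
      case (P t s)
      then have "t = u" using that nP by (cases t; cases u) auto
      then show ?thesis using P that Q by auto
    qed (use that in auto)
    then show "hit j Q = {}" by (auto simp: hit_def Q_def)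
  qed (use Q in auto)
  have "P u u \<in> accepted j"
  proof (rule ccontr)
    assume n: "P u u \<notin> accepted j"
    have "conflict_free (restrict level_AF Q) {P u u}"
      using Q by (auto simp: conflict_free_def)
    moreover have "range_plus (restrict level_AF Q) {P u u} = Q"
      using Q by (auto simp: range_plus_def Q_def)
    moreover have "range_plus (restrict level_AF Q) (accepted j \<inter> Q) \<subseteq> Q"
      by (auto simp: range_plus_def)
    \<comment> \<open>Within \<open>Q\<close> only \<open>P u u\<close> and \<open>H u\<close>
      itself attack \<open>H u\<close>, and the latter is never accepted.\<close>
    moreover have "H u \<notin> range_plus (restrict level_AF Q) (accepted j \<inter> Q)"
      using n by (auto simp: range_plus_def Q_def)
    ultimately show False using st Q(2) unfolding stage_ext_def by blast
  qed
  moreover have "inner (P u u) (P t (\<not> t))" for t by auto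
  ultimately show ?thesis
    unfolding crossed_def using inner_conflict by blast
qed

text \<open>All levels above an uncrossed one are crossed, but the next level, being crossed, needs
  an uncrossed level above it. If every level is crossed, any of them lacks the uncrossed level it
  needs.\<close>

lemma contradiction: False
proof -
  have iff: "crossed j \<longleftrightarrow> (\<exists>i. \<not> crossed (j + Suc i))" for j
    using crossed_if_connected not_crossed_if_disconnected by blast
  show False
  proof (cases "\<exists>j. \<not> crossed j")
    case True
    then obtain j where j: "\<And>i. crossed (j + Suc i)" using iff by blast
    have "crossed (Suc j)" using j[of 0] by simp
    then obtain i where "\<not> crossed (Suc j + Suc i)" using iff by blast
    then show False using j[of "Suc i"] by simp
  next
    case False
    then show False using iff by blast
  qed
qed

end

section \<open>Transfer to the natural numbers\<close>

theorem theorem2: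
  shows "\<exists>F :: nat AF. wf_AF F \<and> finitary F \<and> tfstg2 F = {}"
proof (intro exI conjI)
  let ?f = "to_nat :: nat \<times> node \<Rightarrow> nat"
  have f: "inj ?f" by simp
  show "wf_AF (rename ?f yablo_AF)"
    by (rule wf_AF_rename) (simp add: wf_AF_def)
  show "finitary (rename ?f yablo_AF)"
    by (rule finitary_rename[OF f finitary_yablo_AF])
  show "tfstg2 (rename ?f yablo_AF) = {}"
  proof (rule equals0I)
    fix S' assume S': "S' \<in> tfstg2 (rename ?f yablo_AF)"
    \<comment> \<open>An extension contains only arguments, so it is the image of a set of pairs, to
      which the locale applies.\<close>
    then have "S' \<subseteq> range ?f" by (simp add: tfstg2_def conflict_free_def)
    then obtain S where S: "S' = ?f ` S" by (auto simp: subset_image_iff)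
    interpret yablo_ext S
    proof
      show "conflict_free yablo_AF S"
        using S' by (simp add: tfstg2_def S conflict_free_rename)
      show "stage_ext (restrict yablo_AF X) (S \<inter> X)"
        if "X \<in> Ctower yablo_AF S a" "a \<in> X" "Cstep yablo_AF S a X = X" for a X
        using tfstg2_rename_stage[OF f, of S yablo_AF a X] S' that by (simp add: S)
    qed
    show False by (rule contradiction)
  qed
qed

end
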